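(* Let $s\ge 2$ and $m\ge 1$ be integers and $n=sm-2$. Then $$a(n,s)=\sum_{t=m}^{n}\binom{n}{t}.$$ Moreover, a family $\mathcal F\subset 2^{[n]}$ containing no almost-matching of size $s$ has $|\mathcal F|=a(n,s)$ only if $\mathcal F=\{F\subset[n]:|F|\ge m\}$.
   Context: Sets $F_1,\ldots,F_s$ form an almost-matching (of size $s$) if in the family $\{F_1,\ldots,F_s\}$ at most one element of $[n]$ has degree greater than one, and that element has degree at most two (the degree of an element is the number of the sets $F_i$ containing it). $a(n,s)=\max\{|\mathcal F|:\mathcal F\subset 2^{[n]},\ \mathcal F\text{ contains no almost-matching of size } s\}$. *)

theory Defs
  imports Main
begin

text \<open>
  A choice of sets \<open>F\<^sub>1, \<dots>, F\<^sub>s\<close> is an indexed family, and repetitions are allowed: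
  degrees count indices, so a repeated set counts with multiplicity. Thus \<open>s\<close> copies of the
  empty set, or two copies of a singleton together with further sets that are pairwise disjoint
  and disjoint from it, are almost-matchings.
  With pairwise distinct sets only, \<open>Pow {}\<close> would contain no almost-matching of size 2
  and \<open>a 0 2\<close> would be 1 instead of 0.
\<close>

definition degree :: "nat \<Rightarrow> (nat \<Rightarrow> nat set) \<Rightarrow> nat \<Rightarrow> nat" where
  "degree s F x = card {i \<in> {1..s}. x \<in> F i}"

definition almost_matching :: "nat \<Rightarrow> nat \<Rightarrow> (nat \<Rightarrow> nat set) \<Rightarrow> bool" where
  "almost_matching n s F \<longleftrightarrow>
     card {x \<in> {1..n}. degree s F x > 1} \<le> 1 \<and>
     (\<forall>x \<in> {1..n}. degree s F x \<le> 2)"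

definition contains_almost_matching :: "nat \<Rightarrow> nat \<Rightarrow> nat set set \<Rightarrow> bool" where
  "contains_almost_matching n s \<F> \<longleftrightarrow>
     (\<exists>F. (\<forall>i \<in> {1..s}. F i \<in> \<F>) \<and> almost_matching n s F)"

text \<open>
  For \<open>s \<ge> 1\<close> the maximum ranges over a nonempty finite set, as the empty family qualifies.
\<close>

definition a :: "nat \<Rightarrow> nat \<Rightarrow> nat" where
  "a n s = Max {card \<F> | \<F>. \<F> \<subseteq> Pow {1..n} \<and> \<not> contains_almost_matching n s \<F>}"

end

theory Submission
  imports Defs "HOL-Combinatorics.Permutations"
begin

text \<open>
  Passing to the up-closure, let \<open>\<F>\<close> be an up-closed family on \<open>[n]\<close> without almost-matchings of
  size \<open>s\<close>, and let \<open>N \<F>\<close> consist of the sets obtained from members of \<open>\<F>\<close> by deleting at most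
  one element. Adding a new point to the sets of \<open>N \<F>\<close> and joining the result with \<open>\<F>\<close> gives a
  family on \<open>n + 1 = sm - 1\<close> points without \<open>s\<close> pairwise disjoint members, so by Kleitman's theorem
  \<open>|\<F>| + |N \<F>| \<le> b n m + b n (m - 1)\<close>, where \<open>b n m\<close> is the number of subsets of \<open>[n]\<close> with
  at least \<open>m\<close> elements. On the other hand Harper's isoperimetric inequality says that
  \<open>|\<F>| \<ge> b n m\<close> implies \<open>|N \<F>| \<ge> b n (m - 1)\<close>, with equality throughout only for the family of
  all sets with at least \<open>m\<close> elements. For shifted families this is an easy induction on \<open>n\<close>, and
  shifting neither enlarges \<open>|N \<F>|\<close> nor changes the sizes of the members of \<open>\<F>\<close>.
\<close>

section \<open>Up-closed families, matchings and the family of all large sets\<close>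

definition up_closed :: "'a set \<Rightarrow> 'a set set \<Rightarrow> bool" where
  "up_closed U \<F> \<longleftrightarrow> \<F> \<subseteq> Pow U \<and> (\<forall>A\<in>\<F>. \<forall>B. A \<subseteq> B \<longrightarrow> B \<subseteq> U \<longrightarrow> B \<in> \<F>)"

text \<open>Indexed, so the empty set may be repeated: a family containing it has matchings of every
  size.\<close>

definition has_matching :: "nat \<Rightarrow> 'a set set \<Rightarrow> bool" where
  "has_matching s \<F> \<longleftrightarrow> (\<exists>A. (\<forall>i<s. A i \<in> \<F>) \<and> (\<forall>i<s. \<forall>j<s. i \<noteq> j \<longrightarrow> A i \<inter> A j = {}))"

definition large_sets :: "'a set \<Rightarrow> nat \<Rightarrow> 'a set set" where
  "large_sets U m = {A. A \<subseteq> U \<and> m \<le> card A}"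

lemma up_closedD: "up_closed U \<F> \<Longrightarrow> A \<in> \<F> \<Longrightarrow> A \<subseteq> B \<Longrightarrow> B \<subseteq> U \<Longrightarrow> B \<in> \<F>"
  by (auto simp: up_closed_def)

lemma up_closed_subset: "up_closed U \<F> \<Longrightarrow> A \<in> \<F> \<Longrightarrow> A \<subseteq> U"
  by (auto simp: up_closed_def)

lemma finite_large_sets: "finite U \<Longrightarrow> finite (large_sets U m)"
  by (auto simp: large_sets_def)

lemma card_large_sets:
  assumes "finite U"
  shows "card (large_sets U m) = (\<Sum>t = m..card U. card U choose t)"
proof -
  have "large_sets U m = (\<Union>t\<in>{m..card U}. {A. A \<subseteq> U \<and> card A = t})"
    using assms by (auto simp: large_sets_def intro: card_mono)
  moreover have "card (\<Union>t\<in>{m..card U}. {A. A \<subseteq> U \<and> card A = t})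
      = (\<Sum>t = m..card U. card {A. A \<subseteq> U \<and> card A = t})"
    using assms by (intro card_UN_disjoint) auto
  ultimately show ?thesis
    using assms by (simp add: n_subsets)
qed

section \<open>Kleitman's theorem\<close>

lemma Suc_times_binomial_Suc: "Suc j * (N choose Suc j) = (N - j) * (N choose j)"
  using binomial_absorb_comp[of N j] binomial_absorption[of j N] by simp

text \<open>The ratio of the two binomials is \<open>(N - k) / (k + 1)\<close>, which is exactly
  \<open>t\<close> for this \<open>N\<close>.\<close>

lemma binomial_block_eq:
  assumes "N = t * Suc k + k"
  shows "N choose Suc k = t * (N choose k)"
proof -
  have "Suc k * (N choose Suc k) = Suc k * (t * (N choose k))"
    unfolding Suc_times_binomial_Suc using assms by (simp add: algebra_simps)
  then show ?thesis
    by (simp only: mult_cancel1) simp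
qed

text \<open>Induction on \<open>l\<close>. With \<open>m = k + 1\<close> and
  \<open>u = l + 1\<close>, the step to \<open>l + 1\<close> multiplies the left side by
  \<open>(m - u) / (t * m + u)\<close> and the right side by \<open>(t * m - u) / (m + u)\<close>.
  The second factor is at least the first because \<open>m \<le> t * m\<close>.\<close>

lemma binomial_block_le:
  assumes N: "N = t * Suc k + k" and "t \<ge> 1" and "l \<le> k"
  shows "t * (N choose (k - l)) \<le> N choose (Suc k + l)"
  using \<open>l \<le> k\<close>
proof (induction l)
  case 0
  then show ?case
    using binomial_block_eq[OF N] by simp
next
  case (Suc l)
  define m where "m = Suc k"
  define u where "u = Suc l"
  have um: "u \<le> m" "u < m" using Suc.prems by (auto simp: m_def u_def)
  have tm: "m \<le> t * m" using \<open>t \<ge> 1\<close> by simp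
  define L L' R R' where "L = N choose (k - l)" and "L' = N choose (k - Suc l)"
    and "R = N choose (Suc k + l)" and "R' = N choose (Suc k + Suc l)"
  have IH: "t * L \<le> R"
    using Suc by (simp add: L_def R_def)
  have 1: "(m - u) * L = (t * m + u) * L'"
    using Suc_times_binomial_Suc[of "k - Suc l" N] Suc.prems N
    by (simp add: L_def L'_def m_def u_def Suc_diff_Suc)
  have 2: "(m + u) * R' = (t * m - u) * R"
    using Suc_times_binomial_Suc[of "Suc k + l" N] N
    by (simp add: R_def R'_def m_def u_def)
  have "((m + u) * (t * m + u)) * (t * L') = (m - u) * (m + u) * (t * L)"
    using 1 by (metis (no_types, opaque_lifting) mult.assoc mult.commute)
  also have "\<dots> \<le> (t * m - u) * (t * m + u) * R"
    using tm by (intro mult_mono IH diff_le_mono add_right_mono) auto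
  also have "\<dots> = ((m + u) * (t * m + u)) * R'"
    using 2 by (metis (no_types, opaque_lifting) mult.assoc mult.commute)
  finally have "t * L' \<le> R'"
    using um by (simp only: mult_le_cancel1) auto
  then show ?case
    by (simp add: L'_def R'_def)
qed

text \<open>In this range each binomial is at least twice its predecessor, so the sum is bounded
  like a geometric series.\<close>

lemma sum_binomial_le_double:
  assumes "3 * k \<le> N + 1"
  shows "(\<Sum>j\<le>k. N choose j) \<le> 2 * (N choose k)"
  using assms
proof (induction k)
  case (Suc k)
  have "Suc k * (2 * (N choose k)) \<le> (N - k) * (N choose k)"
    using Suc.prems by (simp only: mult.assoc[symmetric]) (intro mult_right_mono; simp)
  also have "\<dots> = Suc k * (N choose Suc k)"
    by (rule Suc_times_binomial_Suc[symmetric])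
  finally have "2 * (N choose k) \<le> N choose Suc k"
    by (simp only: Suc_mult_le_cancel1)
  then show ?case
    using Suc by simp
qed simp

text \<open>
  If the tail with its first \<open>l\<close> elements removed lies in the family, then at least one of the
  \<open>t\<close> blocks does not. Either there are two such blocks, and their weight suffices because the
  weights on the left decay geometrically; or there is a single such block, which then stays
  outside the family even when the removed elements are given to it.
\<close>

lemma block_inequality:
  fixes t k N :: nat
  defines "I \<equiv> \<lambda>i. {i * Suc k..<Suc i * Suc k}"
    and "X \<equiv> \<lambda>l. {t * Suc k..<t * Suc k + l}"
    and "T \<equiv> \<lambda>l. {t * Suc k + l..<N}"
  assumes N: "N = t * Suc k + k" and t: "t \<ge> 1"
    and up: "up_closed {..<N} \<H>" and no: "\<not> has_matching (Suc t) \<H>"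
  shows "(\<Sum>l\<le>k. of_bool (T l \<in> \<H>) * (t * (N choose (k - l))))
    \<le> (\<Sum>i<t. \<Sum>l\<le>k. of_bool (I i \<union> X l \<notin> \<H>) * (N choose (Suc k + l)))" (is "?lhs \<le> ?rhs")
proof (cases "\<exists>l\<le>k. T l \<in> \<H>")
  case False
  then show ?thesis by simp
next
  case True
  \<comment> \<open>\<open>q\<close> is the largest number of initial tail elements whose removal
    leaves a member; the terms on the left with \<open>l > q\<close> vanish.\<close>
  define q where "q = (GREATEST l. l \<le> k \<and> T l \<in> \<H>)"
  have q: "q \<le> k" "T q \<in> \<H>"
    using GreatestI_ex_nat[of "\<lambda>l. l \<le> k \<and> T l \<in> \<H>" k] True by (auto simp: q_def)
  have q_max: "l \<le> q" if "l \<le> k" "T l \<in> \<H>" for l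
    unfolding q_def using that by (intro Greatest_le_nat[where b = k]) auto
  have lhs: "?lhs \<le> (\<Sum>l\<le>q. t * (N choose (k - l)))"
  proof -
    have "?lhs = (\<Sum>l\<le>q. of_bool (T l \<in> \<H>) * (t * (N choose (k - l))))"
      using q q_max by (intro sum.mono_neutral_right) auto
    also have "\<dots> \<le> (\<Sum>l\<le>q. t * (N choose (k - l)))"
      by (intro sum_mono) simp
    finally show ?thesis .
  qed
  have I_le: "Suc i * Suc k \<le> t * Suc k" if "i < t" for i
    using that by (intro mult_le_mono1) simp
  have I_sub: "I i \<subseteq> {..<t * Suc k}" if "i < t" for i
    using I_le[OF that] by (auto simp: I_def)
  have I_disj: "I i \<inter> I j = {}" if "i \<noteq> j" for i j
  proof -
    have "I i \<inter> I j = {}" if "i < j" for i j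
    proof -
      have "Suc i * Suc k \<le> j * Suc k" using that by (intro mult_le_mono1) simp
      then show ?thesis by (auto simp: I_def)
    qed
    then show ?thesis using \<open>i \<noteq> j\<close> by (metis inf_commute nat_neq_iff)
  qed
  define M where "M = {i. i < t \<and> I i \<notin> \<H>}"
  have "finite M" by (simp add: M_def)
  \<comment> \<open>Otherwise the other blocks, block \<open>i\<close> enlarged by
    \<open>X q\<close>, and the tail \<open>T q\<close> are \<open>t + 1\<close> disjoint
    members.\<close>
  have give: "\<exists>j<t. j \<noteq> i \<and> I j \<notin> \<H>" if i: "i < t" and "I i \<union> X q \<in> \<H>" for i
  proof (rule ccontr)
    assume neg: "\<not> ?thesis"
    define A where "A j = (if j = t then T q else if j = i then I i \<union> X q else I j)" for j
    have "A j \<in> \<H>" if "j < Suc t" for j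
      using neg that q \<open>I i \<union> X q \<in> \<H>\<close> by (auto simp: A_def less_Suc_eq)
    moreover have "A j \<inter> A j' = {}" if "j < j'" "j' < Suc t" for j j'
    proof -
      have "j < t" using that by simp
      moreover have "X q \<inter> T q = {}" by (auto simp: X_def T_def)
      moreover have "X q \<inter> I c = {}" "I c \<inter> X q = {}" "I c \<inter> T q = {}" if "c < t" for c
        using I_sub[OF that] by (auto simp: X_def T_def)
      ultimately show ?thesis
        using that I_disj[of j j'] i
        by (simp add: A_def less_Suc_eq Int_Un_distrib Int_Un_distrib2) blast
    qed
    ultimately have "has_matching (Suc t) \<H>"
      unfolding has_matching_def by (metis inf_commute nat_neq_iff)
    with no show False by simp
  qed
  have "I i \<union> X q \<subseteq> {..<N}" if "i < t" for i
    using I_sub[OF that] q by (force simp: X_def N)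
  moreover have "X l \<subseteq> X q" if "l \<le> q" for l
    using that by (auto simp: X_def)
  ultimately have mono: "I i \<union> X l \<notin> \<H>" if "i < t" "l \<le> q" "I i \<union> X q \<notin> \<H>" for i l
    using up_closedD[OF up, of "I i \<union> X l" "I i \<union> X q"] that by blast
  have "M \<noteq> {}"
  proof
    assume "M = {}"
    then have "\<And>i. i < t \<Longrightarrow> I i \<union> X q \<in> \<H>"
      using mono[of _ 0] by (auto simp: M_def X_def)
    with give[of 0] t \<open>M = {}\<close> show False by (auto simp: M_def)
  qed
  show ?thesis
  proof (cases "card M = 1")
    case True
    then obtain i where i: "M = {i}" by (auto simp: card_1_singleton_iff)
    then have "i < t" by (auto simp: M_def)
    have "I i \<union> X q \<notin> \<H>"
      using give[OF \<open>i < t\<close>] i by (auto simp: M_def)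
    note miss = mono[OF \<open>i < t\<close> _ this]
    \<comment> \<open>The single block outside \<open>\<H>\<close> stays outside for every
      \<open>l \<le> q\<close>, so its contributions dominate the left side term by term.\<close>
    have "(\<Sum>l\<le>q. t * (N choose (k - l))) \<le> (\<Sum>l\<le>q. N choose (Suc k + l))"
      using q by (intro sum_mono binomial_block_le N t) simp
    also have "\<dots> = (\<Sum>l\<le>q. of_bool (I i \<union> X l \<notin> \<H>) * (N choose (Suc k + l)))"
      using miss by (intro sum.cong) auto
    also have "\<dots> \<le> (\<Sum>l\<le>k. of_bool (I i \<union> X l \<notin> \<H>) * (N choose (Suc k + l)))"
      using q by (intro sum_mono2) auto
    also have "\<dots> \<le> ?rhs"
      using \<open>i < t\<close> by (intro member_le_sum) auto
    finally show ?thesis using lhs by simp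
  next
    case False
    with \<open>M \<noteq> {}\<close> \<open>finite M\<close> have M2: "2 \<le> card M"
      by (metis Suc_1 card_0_eq less_2_cases_iff not_less numeral_2_eq_2 One_nat_def)
    have "card M \<le> card {..<t}" by (intro card_mono) (auto simp: M_def)
    with M2 have "2 \<le> t" by simp
    then have "2 * Suc k \<le> t * Suc k" by (intro mult_le_mono1)
    \<comment> \<open>Now \<open>t \<ge> 2\<close> puts \<open>k\<close> in the doubling range, so
      the left side is at most twice \<open>N choose Suc k\<close>; the terms \<open>l = 0\<close>
      of two blocks in \<open>M\<close> pay for it.\<close>
    then have N3: "3 * k \<le> N + 1" by (simp add: N)
    have "(\<Sum>l\<le>q. N choose (k - l)) \<le> (\<Sum>l\<le>k. N choose (k - l))"
      using q by (intro sum_mono2) auto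
    also have "\<dots> = (\<Sum>j\<le>k. N choose j)"
      by (rule sum.reindex_bij_witness[of _ "\<lambda>j. k - j" "\<lambda>j. k - j"]) auto
    also have "\<dots> \<le> 2 * (N choose k)"
      by (rule sum_binomial_le_double[OF N3])
    finally have "t * (\<Sum>l\<le>q. N choose (k - l)) \<le> t * (2 * (N choose k))"
      by (rule mult_le_mono2)
    then have "?lhs \<le> 2 * (N choose Suc k)"
      using lhs by (simp add: binomial_block_eq[OF N] sum_distrib_left algebra_simps)
    also have "\<dots> \<le> (\<Sum>i\<in>M. N choose Suc k)"
      using M2 by simp
    also have "\<dots> \<le> (\<Sum>i\<in>M. \<Sum>l\<le>k. of_bool (I i \<union> X l \<notin> \<H>) * (N choose (Suc k + l)))"
    proof (rule sum_mono)
      fix i assume "i \<in> M"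
      then have "N choose Suc k = of_bool (I i \<union> X 0 \<notin> \<H>) * (N choose (Suc k + 0))"
        by (simp add: M_def X_def)
      also have "\<dots> \<le> (\<Sum>l\<le>k. of_bool (I i \<union> X l \<notin> \<H>) * (N choose (Suc k + l)))"
        by (rule member_le_sum) auto
      finally show "N choose Suc k \<le> \<dots>" .
    qed
    also have "\<dots> \<le> ?rhs"
      by (intro sum_mono2) (auto simp: M_def)
    finally show ?thesis .
  qed
qed

section \<open>Averaging over permutations\<close>

lemma ex_permutes_image_eq:
  assumes "finite U" "S \<subseteq> U" "S' \<subseteq> U" "card S = card S'"
  obtains q where "q permutes U" "q ` S = S'"
proof -
  have fin: "finite S" "finite S'" "finite (U - S)" "finite (U - S')"
    using assms by (auto intro: finite_subset)
  obtain f where f: "bij_betw f S S'"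
    using finite_same_card_bij[OF fin(1,2) assms(4)] by blast
  have "card (U - S) = card (U - S')"
    using assms fin by (simp add: card_Diff_subset)
  then obtain g where g: "bij_betw g (U - S) (U - S')"
    using finite_same_card_bij[OF fin(3,4)] by blast
  define q where "q x = (if x \<in> S then f x else if x \<in> U then g x else x)" for x
  have "bij_betw q S S'"
    using f by (subst bij_betw_cong[where g = f]) (auto simp: q_def)
  moreover have "bij_betw q (U - S) (U - S')"
    using g by (subst bij_betw_cong[where g = g]) (auto simp: q_def)
  ultimately have "bij_betw q (S \<union> (U - S)) (S' \<union> (U - S'))"
    by (rule bij_betw_combine) auto
  moreover have "S \<union> (U - S) = U" "S' \<union> (U - S') = U" using assms by auto
  ultimately have "q permutes U"
    using assms(2) by (intro bij_imp_permutes) (auto simp: q_def)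
  moreover have "q ` S = S'"
    using \<open>bij_betw q S S'\<close> by (simp add: bij_betw_def)
  ultimately show ?thesis by (rule that)
qed

text \<open>Double counting of pairs of a permutation \<open>p\<close> and a set \<open>A\<close> of
  the size of \<open>S\<close> whose image under \<open>p\<close> lies in \<open>\<F>\<close>.
  Composing with a permutation that takes \<open>S\<close> to \<open>A\<close> shows that every
  \<open>A\<close> has as many \<open>p\<close> as \<open>S\<close>; for fixed \<open>p\<close> the
  sets \<open>A\<close> correspond to the members of \<open>\<F>\<close> of that size.\<close>

lemma card_permutes_image_mem:
  assumes U: "finite U" and S: "S \<subseteq> U" and \<F>: "\<F> \<subseteq> Pow U"
  shows "(card U choose card S) * card {p. p permutes U \<and> p ` S \<in> \<F>}
    = fact (card U) * card {A \<in> \<F>. card A = card S}"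
proof -
  define P where "P = {p. p permutes U}"
  define L where "L = {A. A \<subseteq> U \<and> card A = card S}"
  have finP: "finite P" and cardP: "card P = fact (card U)"
    using U by (auto simp: P_def finite_permutations card_permutations)
  have finL: "finite L" using U by (simp add: L_def)
  have const: "card {p \<in> P. p ` A \<in> \<F>} = card {p \<in> P. p ` S \<in> \<F>}" if A: "A \<in> L" for A
  proof -
    obtain q where q: "q permutes U" "q ` S = A"
      using ex_permutes_image_eq[OF U S, of A] A by (auto simp: L_def)
    have "bij_betw (\<lambda>p. p \<circ> q) {p \<in> P. p ` A \<in> \<F>} {p \<in> P. p ` S \<in> \<F>}"
    proof (rule bij_betw_byWitness[where f' = "\<lambda>p. p \<circ> inv q"])
      have inv: "q \<circ> inv q = id" "inv q \<circ> q = id" "inv q ` A = S"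
        using permutes_inv_o[OF q(1)] q permutes_inj[OF q(1)]
        by (auto simp: image_inv_f_f)
      show "\<forall>p\<in>{p \<in> P. p ` A \<in> \<F>}. p \<circ> q \<circ> inv q = p"
        "\<forall>p\<in>{p \<in> P. p ` S \<in> \<F>}. p \<circ> inv q \<circ> q = p"
        using inv by (auto simp: comp_assoc)
      have "(p \<circ> q) ` S = p ` A" "(p \<circ> inv q) ` A = p ` S" for p :: "'a \<Rightarrow> 'a"
        using q(2) inv(3) by (metis image_comp)+
      then show "(\<lambda>p. p \<circ> q) ` {p \<in> P. p ` A \<in> \<F>} \<subseteq> {p \<in> P. p ` S \<in> \<F>}"
        "(\<lambda>p. p \<circ> inv q) ` {p \<in> P. p ` S \<in> \<F>} \<subseteq> {p \<in> P. p ` A \<in> \<F>}"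
        using permutes_compose[OF q(1)] permutes_compose[OF permutes_inv[OF q(1)]]
        by (auto simp: P_def)
    qed
    then show ?thesis by (rule bij_betw_same_card)
  qed
  have level: "card {A \<in> L. p ` A \<in> \<F>} = card {A \<in> \<F>. card A = card S}" if p: "p \<in> P" for p
  proof (rule bij_betw_same_card[of "(`) p"])
    have p: "p permutes U" using p by (simp add: P_def)
    have inj: "inj p" using p by (rule permutes_inj)
    have "B \<in> (`) p ` {A \<in> L. p ` A \<in> \<F>}" if B: "B \<in> \<F>" "card B = card S" for B
    proof
      show "B = p ` (inv p ` B)"
        using permutes_surj[OF p] by (simp add: image_f_inv_f)
      moreover have "inv p ` B \<subseteq> U"
        using B \<F> permutes_image[OF permutes_inv[OF p]] by blast
      moreover have "card (inv p ` B) = card B"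
        using permutes_inj[OF permutes_inv[OF p]] by (intro card_image) (blast intro: inj_on_subset)
      ultimately show "inv p ` B \<in> {A \<in> L. p ` A \<in> \<F>}"
        using B by (simp add: L_def)
    qed
    moreover have "card (p ` A) = card A" for A
      using inj by (intro card_image) (blast intro: inj_on_subset)
    ultimately show "bij_betw ((`) p) {A \<in> L. p ` A \<in> \<F>} {A \<in> \<F>. card A = card S}"
      using inj by (auto simp: bij_betw_def L_def inj_on_def inj_image_eq_iff)
  qed
  have "(card U choose card S) * card {p \<in> P. p ` S \<in> \<F>} = (\<Sum>A\<in>L. card {p \<in> P. p ` A \<in> \<F>})"
    using const n_subsets[OF U] by (simp add: L_def)
  also have "\<dots> = (\<Sum>p\<in>P. card {A \<in> L. p ` A \<in> \<F>})"
    using finP finL by (intro sum_multicount_gen) auto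
  also have "\<dots> = fact (card U) * card {A \<in> \<F>. card A = card S}"
    using level cardP by simp
  finally show ?thesis by (simp add: P_def)
qed

lemma has_matching_mono_image:
  assumes p: "inj p" and "has_matching s \<H>" and "\<And>A. A \<in> \<H> \<Longrightarrow> p ` A \<in> \<G>"
  shows "has_matching s \<G>"
proof -
  obtain A where A: "\<forall>i<s. A i \<in> \<H>" "\<forall>i<s. \<forall>j<s. i \<noteq> j \<longrightarrow> A i \<inter> A j = {}"
    using assms(2) unfolding has_matching_def by (elim exE conjE)
  have "\<forall>i<s. p ` A i \<in> \<G>"
    using A(1) assms(3) by simp
  moreover have "\<forall>i<s. \<forall>j<s. i \<noteq> j \<longrightarrow> p ` A i \<inter> p ` A j = {}"
    using A(2) image_Int[OF p] by (metis image_empty)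
  ultimately show ?thesis
    unfolding has_matching_def by (intro exI[of _ "\<lambda>i. p ` A i"] conjI)
qed

text \<open>The case of \<open>N = s * m - 1\<close> points, with \<open>s = t + 1\<close> and
  \<open>m = k + 1\<close>. The block inequality is summed over all relabellings of the points; its
  binomial weights turn each sum over permutations into a count of sets of one size. Hence the
  members with fewer than \<open>m\<close> elements are at most as many as the missing sets with at
  least \<open>m\<close>.\<close>

theorem Kleitman:
  assumes N: "N = t * Suc k + k" and t: "t \<ge> 1"
    and up: "up_closed {..<N} \<G>" and no: "\<not> has_matching (Suc t) \<G>"
  shows "card \<G> \<le> card (large_sets {..<N} (Suc k))"
proof -
  define U where "U = {..<N}"
  have U: "finite U" "card U = N" by (auto simp: U_def)
  have \<G>: "\<G> \<subseteq> Pow U" using up by (simp add: up_closed_def U_def)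
  \<comment> \<open>The points form \<open>t\<close> blocks of size \<open>k + 1\<close> and a tail
    of size \<open>k\<close>. \<open>B i l\<close> is block \<open>i\<close> with the first
    \<open>l\<close> tail points added, \<open>T l\<close> is the rest of the tail.\<close>
  define B where "B i l = {i * Suc k..<Suc i * Suc k} \<union> {t * Suc k..<t * Suc k + l}" for i l
  define T where "T l = {t * Suc k + l..<N}" for l
  have B: "B i l \<subseteq> U" "card (B i l) = Suc k + l" if "i < t" "l \<le> k" for i l
  proof -
    have le: "Suc i * Suc k \<le> t * Suc k" using that by (intro mult_le_mono1) simp
    then show "B i l \<subseteq> U" using that by (auto simp: B_def U_def N)
    have "card (B i l) = card {i * Suc k..<Suc i * Suc k} + card {t * Suc k..<t * Suc k + l}"
      unfolding B_def using le by (intro card_Un_disjoint) auto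
    then show "card (B i l) = Suc k + l" by simp
  qed
  have T: "T l \<subseteq> U" "card (T l) = k - l" if "l \<le> k" for l
    using that by (auto simp: T_def N U_def)
  define P where "P = {p. p permutes U}"
  have finP: "finite P" using U by (simp add: P_def finite_permutations)
  define low where "low l = {A \<in> \<G>. card A = k - l}" for l
  define missing where "missing l = {A \<in> Pow U - \<G>. card A = Suc k + l}" for l

  have count: "(\<Sum>p\<in>P. of_bool (Q p)) = card {p \<in> P. Q p}" if "finite P"
    for P :: "(nat \<Rightarrow> nat) set" and Q
    using that by (simp add: of_bool_def sum.If_cases Int_def)
  have "(\<Sum>l\<le>k. of_bool (p ` T l \<in> \<G>) * (t * (N choose (k - l))))
    \<le> (\<Sum>i<t. \<Sum>l\<le>k. of_bool (p ` B i l \<in> Pow U - \<G>) * (N choose (Suc k + l)))"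
    if "p \<in> P" for p
  proof -
    have p: "p permutes U" using that by (simp add: P_def)
    \<comment> \<open>Pulling \<open>\<G>\<close> back along \<open>p\<close> preserves both
      hypotheses and lets the fixed blocks play the role of their images under
      \<open>p\<close>.\<close>
    define \<H> where "\<H> = {S \<in> Pow U. p ` S \<in> \<G>}"
    have "up_closed U \<H>"
      unfolding up_closed_def
    proof (intro conjI ballI allI impI)
      fix A B assume "A \<in> \<H>" "A \<subseteq> B" "B \<subseteq> U"
      moreover from this have "p ` B \<subseteq> U" using permutes_image[OF p] by blast
      ultimately show "B \<in> \<H>"
        using up_closedD[OF up, of "p ` A" "p ` B"] by (auto simp: \<H>_def U_def)
    qed (auto simp: \<H>_def)
    moreover have "\<not> has_matching (Suc t) \<H>"
      using has_matching_mono_image[OF permutes_inj[OF p]] no by (auto simp: \<H>_def)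
    ultimately have ineq: "(\<Sum>l\<le>k. of_bool (T l \<in> \<H>) * (t * (N choose (k - l))))
      \<le> (\<Sum>i<t. \<Sum>l\<le>k. of_bool (B i l \<notin> \<H>) * (N choose (Suc k + l)))"
      unfolding B_def T_def U_def by (rule block_inequality[OF N t])
    have "T l \<in> \<H> \<longleftrightarrow> p ` T l \<in> \<G>" if "l \<le> k" for l
      using T(1)[OF that] by (simp add: \<H>_def)
    moreover have "B i l \<notin> \<H> \<longleftrightarrow> p ` B i l \<in> Pow U - \<G>" if "i < t" "l \<le> k" for i l
      using B(1)[OF that] permutes_image[OF p] unfolding \<H>_def by blast
    ultimately show ?thesis
      using ineq by simp
  qed
  then have "(\<Sum>p\<in>P. \<Sum>l\<le>k. of_bool (p ` T l \<in> \<G>) * (t * (N choose (k - l))))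
    \<le> (\<Sum>p\<in>P. \<Sum>i<t. \<Sum>l\<le>k. of_bool (p ` B i l \<in> Pow U - \<G>) * (N choose (Suc k + l)))"
    by (rule sum_mono)
  also have "(\<Sum>p\<in>P. \<Sum>l\<le>k. of_bool (p ` T l \<in> \<G>) * (t * (N choose (k - l))))
    = t * fact N * (\<Sum>l\<le>k. card (low l))"
  proof -
    have "(\<Sum>p\<in>P. of_bool (p ` T l \<in> \<G>) * (t * (N choose (k - l)))) = t * fact N * card (low l)"
      if "l \<le> k" for l
    proof -
      have "(\<Sum>p\<in>P. of_bool (p ` T l \<in> \<G>) * (t * (N choose (k - l))))
          = card {p \<in> P. p ` T l \<in> \<G>} * (t * (N choose (k - l)))"
        by (simp only: sum_distrib_right[symmetric] count[OF finP])
      also have "\<dots> = t * ((N choose (k - l)) * card {p \<in> P. p ` T l \<in> \<G>})"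
        by simp
      also have "\<dots> = t * (fact N * card (low l))"
        using card_permutes_image_mem[OF U(1) T(1)[OF that] \<G>] T(2)[OF that] U
        by (simp add: P_def low_def)
      finally show ?thesis by simp
    qed
    then show ?thesis
      by (subst sum.swap) (simp add: sum_distrib_left)
  qed
  also have "(\<Sum>p\<in>P. \<Sum>i<t. \<Sum>l\<le>k.
      of_bool (p ` B i l \<in> Pow U - \<G>) * (N choose (Suc k + l)))
    = t * fact N * (\<Sum>l\<le>k. card (missing l))"
  proof -
    have "(\<Sum>p\<in>P. of_bool (p ` B i l \<in> Pow U - \<G>) * (N choose (Suc k + l)))
        = fact N * card (missing l)" if "i < t" "l \<le> k" for i l
    proof -
      have "(\<Sum>p\<in>P. of_bool (p ` B i l \<in> Pow U - \<G>) * (N choose (Suc k + l)))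
          = card {p \<in> P. p ` B i l \<in> Pow U - \<G>} * (N choose (Suc k + l))"
        by (simp only: sum_distrib_right[symmetric] count[OF finP])
      then show ?thesis
        using card_permutes_image_mem[OF U(1) B(1)[OF that], of "Pow U - \<G>"] B(2)[OF that] U
        by (simp add: P_def missing_def mult.commute)
    qed
    then have eq: "(\<Sum>i<t. \<Sum>l\<le>k. \<Sum>p\<in>P.
        of_bool (p ` B i l \<in> Pow U - \<G>) * (N choose (Suc k + l)))
      = (\<Sum>i<t. \<Sum>l\<le>k. fact N * card (missing l))"
      by (intro sum.cong refl) (simp only: lessThan_iff atMost_iff)
    show ?thesis
      unfolding sum.swap[of _ _ P] eq by (simp add: sum_distrib_left mult_ac)
  qed
  \<comment> \<open>The factor \<open>t * fact N\<close> cancels: on the left \<open>t\<close> is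
    part of the weight, on the right it is the number of blocks.\<close>
  finally have le: "(\<Sum>l\<le>k. card (low l)) \<le> (\<Sum>l\<le>k. card (missing l))"
    using t by simp

  have fin: "finite \<G>" using \<G> U by (blast intro: finite_subset)
  have "(\<Sum>l\<le>k. card (low l)) = card (\<Union>l\<in>{..k}. low l)"
    using fin by (intro card_UN_disjoint[symmetric]) (auto simp: low_def)
  also have "(\<Union>l\<in>{..k}. low l) = {A \<in> \<G>. card A \<le> k}"
  proof (intro equalityI subsetI)
    fix A assume "A \<in> {A \<in> \<G>. card A \<le> k}"
    then have "A \<in> low (k - card A)" by (simp add: low_def)
    then show "A \<in> (\<Union>l\<in>{..k}. low l)" by auto
  qed (auto simp: low_def)
  finally have low: "(\<Sum>l\<le>k. card (low l)) = card {A \<in> \<G>. card A \<le> k}" .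
  have "(\<Sum>l\<le>k. card (missing l)) = card (\<Union>l\<in>{..k}. missing l)"
    using U by (intro card_UN_disjoint[symmetric]) (auto simp: missing_def)
  also have "\<dots> \<le> card (large_sets U (Suc k) - \<G>)"
    using U by (intro card_mono) (auto simp: missing_def large_sets_def)
  finally have "card {A \<in> \<G>. card A \<le> k} \<le> card (large_sets U (Suc k) - \<G>)"
    using le low by simp
  moreover have "card \<G> = card {A \<in> \<G>. card A \<le> k} + card (large_sets U (Suc k) \<inter> \<G>)"
    using fin \<G> by (subst card_Un_disjoint[symmetric])
      (auto simp: large_sets_def intro!: arg_cong[of _ _ card])
  moreover have "card (large_sets U (Suc k))
      = card (large_sets U (Suc k) - \<G>) + card (large_sets U (Suc k) \<inter> \<G>)"
    using U finite_large_sets[OF U(1)] by (subst card_Un_disjoint[symmetric]) (auto simp: Un_Diff_Int)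
  ultimately show ?thesis by (simp add: U_def)
qed

section \<open>Neighbourhoods of shifted families\<close>

text \<open>Adding a point never leaves an up-closed family, so for such families this is the closed
  neighbourhood in the Hamming cube.\<close>

definition nbhd :: "'a set set \<Rightarrow> 'a set set" where
  "nbhd \<F> = \<F> \<union> {A - {x} | A x. A \<in> \<F>}"

text \<open>Elements are pushed upwards, towards \<open>n\<close>, so that the last point is the one
  to split off in inductions.\<close>

definition shifted :: "nat \<Rightarrow> nat set set \<Rightarrow> bool" where
  "shifted n \<F> \<longleftrightarrow>
    (\<forall>A\<in>\<F>. \<forall>i\<in>A. \<forall>j\<le>n. i < j \<longrightarrow> j \<notin> A \<longrightarrow> insert j (A - {i}) \<in> \<F>)"

definition avoiding :: "'a \<Rightarrow> 'a set set \<Rightarrow> 'a set set" where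
  "avoiding x \<F> = {A \<in> \<F>. x \<notin> A}"

definition link :: "'a \<Rightarrow> 'a set set \<Rightarrow> 'a set set" where
  "link x \<F> = {A. x \<notin> A \<and> insert x A \<in> \<F>}"

lemma subset_nbhd: "\<F> \<subseteq> nbhd \<F>"
  by (auto simp: nbhd_def)

lemma Diff_in_nbhd: "A \<in> \<F> \<Longrightarrow> A - {x} \<in> nbhd \<F>"
  by (auto simp: nbhd_def)

lemma nbhd_iff: "C \<in> nbhd \<F> \<longleftrightarrow> (\<exists>A\<in>\<F>. \<exists>x. C = A \<or> C = A - {x})"
  by (auto simp: nbhd_def)

lemma nbhd_subset_Pow: "\<F> \<subseteq> Pow U \<Longrightarrow> nbhd \<F> \<subseteq> Pow U"
  by (auto simp: nbhd_def)

text \<open>If \<open>B\<close> misses the deleted element \<open>x\<close>, then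
  \<open>insert x B\<close> contains the original member, and \<open>B\<close> is a deletion from
  it.\<close>

lemma up_closed_nbhd:
  assumes "up_closed U \<F>"
  shows "up_closed U (nbhd \<F>)"
  unfolding up_closed_def
proof (intro conjI ballI allI impI)
  show "nbhd \<F> \<subseteq> Pow U"
    using assms by (intro nbhd_subset_Pow) (simp add: up_closed_def)
  fix C B assume "C \<in> nbhd \<F>" and B: "C \<subseteq> B" "B \<subseteq> U"
  then obtain A x where A: "A \<in> \<F>" "C = A \<or> C = A - {x}" by (auto simp: nbhd_iff)
  show "B \<in> nbhd \<F>"
  proof (cases "A \<subseteq> B")
    case True
    then show ?thesis
      using up_closedD[OF assms A(1) _ B(2)] subset_nbhd by blast
  next
    case False
    then have x: "C = A - {x}" "x \<in> A" "x \<notin> B" using A B by auto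
    then have "insert x B \<in> \<F>"
      using up_closed_subset[OF assms A(1)] B by (intro up_closedD[OF assms A(1)]) auto
    moreover have "B = insert x B - {x}" using x by simp
    ultimately show ?thesis using Diff_in_nbhd by metis
  qed
qed

lemma card_avoiding_link:
  assumes "finite \<F>"
  shows "card \<F> = card (avoiding x \<F>) + card (link x \<F>)"
proof -
  have inj: "inj_on (insert x) (link x \<F>)"
    by (rule inj_onI) (simp add: link_def insert_ident)
  have "\<F> = avoiding x \<F> \<union> insert x ` link x \<F>"
  proof
    show "\<F> \<subseteq> avoiding x \<F> \<union> insert x ` link x \<F>"
    proof
      fix A assume "A \<in> \<F>"
      then show "A \<in> avoiding x \<F> \<union> insert x ` link x \<F>"
      proof (cases "x \<in> A")
        case True
        with \<open>A \<in> \<F>\<close> have "A - {x} \<in> link x \<F>"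
          by (simp add: link_def insert_absorb)
        moreover have "A = insert x (A - {x})" using True by auto
        ultimately show ?thesis by blast
      qed (simp add: avoiding_def)
    qed
  qed (auto simp: avoiding_def link_def)
  moreover have "avoiding x \<F> \<inter> insert x ` link x \<F> = {}"
    by (auto simp: avoiding_def)
  moreover have "finite (insert x ` link x \<F>)"
    using assms by (rule rev_finite_subset) (auto simp: link_def)
  moreover have "finite (avoiding x \<F>)" using assms by (simp add: avoiding_def)
  ultimately have "card \<F> = card (avoiding x \<F>) + card (insert x ` link x \<F>)"
    by (metis card_Un_disjoint)
  then show ?thesis by (simp add: card_image[OF inj])
qed

lemma avoiding_link_eqI:
  assumes "avoiding x \<F> = avoiding x \<G>" "link x \<F> = link x \<G>"
  shows "\<F> = \<G>"
proof (rule set_eqI)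
  fix A
  show "A \<in> \<F> \<longleftrightarrow> A \<in> \<G>"
  proof (cases "x \<in> A")
    case True
    then have "A \<in> \<K> \<longleftrightarrow> A - {x} \<in> link x \<K>" for \<K>
      by (simp add: link_def insert_absorb)
    then show ?thesis using assms(2) by metis
  next
    case False
    then have "A \<in> \<K> \<longleftrightarrow> A \<in> avoiding x \<K>" for \<K>
      by (simp add: avoiding_def)
    then show ?thesis using assms(1) by metis
  qed
qed

section \<open>Splitting families at the last point\<close>

lemma atLeastAtMost_Suc_insert: "{1..Suc n} = insert (Suc n) {1..n}"
  by auto

lemma avoiding_large_sets:
  "avoiding (Suc n) (large_sets {1..Suc n} m) = large_sets {1..n} m"
  unfolding avoiding_def large_sets_def atLeastAtMost_Suc_insert by auto

text \<open>For \<open>m = 0\<close> both sides are the full power set of \<open>{1..n}\<close>, so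
  the truncated \<open>m - 1\<close> is correct.\<close>

lemma link_large_sets:
  "link (Suc n) (large_sets {1..Suc n} m) = large_sets {1..n} (m - 1)"
proof -
  have "m \<le> card (insert (Suc n) A) \<longleftrightarrow> m - 1 \<le> card A" if "A \<subseteq> {1..n}" for A
  proof -
    have "finite A" "Suc n \<notin> A" using that by (auto intro: finite_subset)
    then show ?thesis by auto
  qed
  then show ?thesis
    unfolding link_def large_sets_def atLeastAtMost_Suc_insert by auto
qed

text \<open>Pascal's rule for tails of the binomial sum.\<close>

lemma card_large_sets_Suc:
  "card (large_sets {1..Suc n} m) = card (large_sets {1..n} m) + card (large_sets {1..n} (m - 1))"
  using card_avoiding_link[OF finite_large_sets, of "{1..Suc n}" m "Suc n"]
  unfolding avoiding_large_sets link_large_sets by simp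

context
  fixes n :: nat and \<F> :: "nat set set"
  assumes up: "up_closed {1..Suc n} \<F>" and sh: "shifted (Suc n) \<F>"
begin

lemma subset_Suc: "A \<in> \<F> \<Longrightarrow> A \<subseteq> insert (Suc n) {1..n}"
  using up_closed_subset[OF up] atLeastAtMost_Suc_insert by auto

lemma up_closed_avoiding: "up_closed {1..n} (avoiding (Suc n) \<F>)"
  unfolding up_closed_def
proof (intro conjI ballI allI impI)
  show "avoiding (Suc n) \<F> \<subseteq> Pow {1..n}"
    using subset_Suc by (auto simp: avoiding_def)
  fix A B assume "A \<in> avoiding (Suc n) \<F>" "A \<subseteq> B" "B \<subseteq> {1..n}"
  then show "B \<in> avoiding (Suc n) \<F>"
    using up_closedD[OF up, of A B] by (fastforce simp: avoiding_def)
qed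

lemma up_closed_link: "up_closed {1..n} (link (Suc n) \<F>)"
  unfolding up_closed_def
proof (intro conjI ballI allI impI)
  show "link (Suc n) \<F> \<subseteq> Pow {1..n}"
    using subset_Suc by (fastforce simp: link_def)
  fix A B assume "A \<in> link (Suc n) \<F>" "A \<subseteq> B" "B \<subseteq> {1..n}"
  then show "B \<in> link (Suc n) \<F>"
    using up_closedD[OF up, of "insert (Suc n) A" "insert (Suc n) B"] by (fastforce simp: link_def)
qed

lemma shifted_avoiding: "shifted n (avoiding (Suc n) \<F>)"
  using sh by (auto simp: shifted_def avoiding_def)

lemma shifted_link: "shifted n (link (Suc n) \<F>)"
  unfolding shifted_def
proof (intro ballI allI impI)
  fix A i j assume *: "A \<in> link (Suc n) \<F>" "i \<in> A" "j \<le> n" "i < j" "j \<notin> A"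
  then have "insert j (insert (Suc n) A - {i}) \<in> \<F>"
    using sh by (auto simp: shifted_def link_def)
  moreover have "insert j (insert (Suc n) A - {i}) = insert (Suc n) (insert j (A - {i}))"
    using * by auto
  ultimately show "insert j (A - {i}) \<in> link (Suc n) \<F>"
    using * by (auto simp: link_def)
qed

lemma nbhd_avoiding_subset_link: "nbhd (avoiding (Suc n) \<F>) \<subseteq> link (Suc n) \<F>"
proof
  fix C assume "C \<in> nbhd (avoiding (Suc n) \<F>)"
  then obtain A x where A: "A \<in> \<F>" "Suc n \<notin> A" "C = A \<or> C = A - {x}"
    by (auto simp: avoiding_def nbhd_iff)
  have "insert (Suc n) C \<in> \<F>"
  proof (cases "A \<subseteq> C")
    case True
    then show ?thesis
      using A subset_Suc[OF A(1)] by (intro up_closedD[OF up A(1)]) (auto simp: le_Suc_eq)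
  next
    case False
    then have "C = A - {x}" "x \<in> A" using A by auto
    moreover from this have "x < Suc n" using A subset_Suc[OF A(1)] by auto
    ultimately show ?thesis using sh A by (auto simp: shifted_def)
  qed
  then show "C \<in> link (Suc n) \<F>" using A by (auto simp: link_def)
qed

lemma link_subset_avoiding_nbhd: "link (Suc n) \<F> \<subseteq> avoiding (Suc n) (nbhd \<F>)"
proof
  fix A assume "A \<in> link (Suc n) \<F>"
  then have "Suc n \<notin> A" "insert (Suc n) A \<in> \<F>" by (auto simp: link_def)
  then show "A \<in> avoiding (Suc n) (nbhd \<F>)"
    using Diff_in_nbhd[of "insert (Suc n) A" \<F> "Suc n"] by (simp add: avoiding_def)
qed

lemma nbhd_link_subset: "nbhd (link (Suc n) \<F>) \<subseteq> link (Suc n) (nbhd \<F>)"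
proof
  fix C assume "C \<in> nbhd (link (Suc n) \<F>)"
  then obtain A x where A: "insert (Suc n) A \<in> \<F>" "Suc n \<notin> A" "C = A \<or> C = A - {x}"
    by (auto simp: link_def nbhd_iff)
  have "insert (Suc n) C \<in> nbhd \<F>"
  proof (cases "C = A")
    case True
    then show ?thesis using A subset_nbhd by auto
  next
    case False
    then have "insert (Suc n) C = insert (Suc n) A - {x}" using A by auto
    then show ?thesis using A Diff_in_nbhd by metis
  qed
  then show "C \<in> link (Suc n) (nbhd \<F>)" using A by (auto simp: link_def)
qed

lemma finite_parts:
  "finite \<F>" "finite (nbhd \<F>)" "finite (avoiding (Suc n) \<F>)" "finite (link (Suc n) \<F>)"
  "finite (avoiding (Suc n) (nbhd \<F>))" "finite (link (Suc n) (nbhd \<F>))"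
proof -
  have sub: "\<F> \<subseteq> Pow {1..Suc n}" "nbhd \<F> \<subseteq> Pow {1..Suc n}"
    using up nbhd_subset_Pow by (auto simp: up_closed_def)
  have fin_Pow: "finite \<G>" if "\<G> \<subseteq> Pow {1..Suc n}" for \<G>
    by (rule finite_subset[OF that]) simp
  show fin: "finite \<F>" "finite (nbhd \<F>)"
    by (intro fin_Pow sub)+
  show "finite (avoiding (Suc n) \<F>)" "finite (avoiding (Suc n) (nbhd \<F>))"
    using fin by (auto simp: avoiding_def)
  have "link (Suc n) \<F> \<subseteq> Pow {1..Suc n}" "link (Suc n) (nbhd \<F>) \<subseteq> Pow {1..Suc n}"
    using sub by (auto simp: link_def)
  then show "finite (link (Suc n) \<F>)" "finite (link (Suc n) (nbhd \<F>))"
    by (simp_all only: fin_Pow)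
qed

text \<open>Allows Harper's inequality to be applied to the link: an empty link would force the part
  avoiding the last point to be empty, as its neighbourhood lies in the link.\<close>

lemma link_nonempty:
  assumes "\<F> \<noteq> {}"
  shows "link (Suc n) \<F> \<noteq> {}"
proof
  assume L: "link (Suc n) \<F> = {}"
  then have "avoiding (Suc n) \<F> = {}"
    using nbhd_avoiding_subset_link subset_nbhd[of "avoiding (Suc n) \<F>"] by simp
  with L have "card \<F> = 0"
    using card_avoiding_link[OF finite_parts(1), of "Suc n"] by simp
  with assms show False using finite_parts(1) by simp
qed

text \<open>Deleting the last point puts the link into one half of the neighbourhood; deleting other
  points puts the neighbourhood of the link into the other half.\<close>

lemma card_nbhd_ge: "card (link (Suc n) \<F>) + card (nbhd (link (Suc n) \<F>)) \<le> card (nbhd \<F>)"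
  unfolding card_avoiding_link[OF finite_parts(2), of "Suc n"]
  by (intro add_mono card_mono finite_parts link_subset_avoiding_nbhd nbhd_link_subset)

end

text \<open>
  The key step of Harper's inequality for shifted families: deleting an element from a member
  avoiding the last point and adding that point gives another member, so the link of the last
  point contains the neighbourhood of the sets avoiding it.
\<close>

lemma card_link_ge:
  assumes IH: "\<And>\<G> m. up_closed {1..n} \<G> \<Longrightarrow> shifted n \<G> \<Longrightarrow> \<G> \<noteq> {} \<Longrightarrow>
      card (large_sets {1..n} m) \<le> card \<G> \<Longrightarrow> card (large_sets {1..n} (m - 1)) \<le> card (nbhd \<G>)"
    and up: "up_closed {1..Suc n} \<F>" and sh: "shifted (Suc n) \<F>"
    and card: "card (large_sets {1..Suc n} m) \<le> card \<F>"
  shows "card (large_sets {1..n} (m - 1)) \<le> card (link (Suc n) \<F>)"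
proof (rule ccontr)
  \<comment> \<open>A link that is too small leaves too many sets avoiding the last point; by
    induction their neighbourhood, and with it the link, is large after all.\<close>
  assume less: "\<not> ?thesis"
  have "card \<F> = card (avoiding (Suc n) \<F>) + card (link (Suc n) \<F>)"
    by (rule card_avoiding_link[OF finite_parts(1)[OF up sh]])
  with less card have *: "card (large_sets {1..n} m) < card (avoiding (Suc n) \<F>)"
    by (simp only: card_large_sets_Suc)
  then have "avoiding (Suc n) \<F> \<noteq> {}" by auto
  then have "card (large_sets {1..n} (m - 1)) \<le> card (nbhd (avoiding (Suc n) \<F>))"
    using * by (intro IH up_closed_avoiding[OF up sh] shifted_avoiding[OF up sh]) auto
  also have "\<dots> \<le> card (link (Suc n) \<F>)"
    by (intro card_mono finite_parts[OF up sh] nbhd_avoiding_subset_link[OF up sh])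
  finally show False using less by simp
qed

text \<open>The link reaches level \<open>m - 1\<close>, its neighbourhood by induction level
  \<open>m - 1 - 1\<close>, and Pascal's rule adds the two. Nonemptiness matters for
  \<open>m = n + 1\<close>, where the size hypothesis is void but the conclusion asks for one
  set.\<close>

lemma shifted_nbhd_ge:
  assumes "up_closed {1..n} \<F>" "shifted n \<F>" "\<F> \<noteq> {}"
    and "card (large_sets {1..n} m) \<le> card \<F>"
  shows "card (large_sets {1..n} (m - 1)) \<le> card (nbhd \<F>)"
  using assms
proof (induction n arbitrary: \<F> m)
  case 0
  then have "\<F> = {{}}" by (auto simp: up_closed_def)
  then have "nbhd \<F> = {{}}" by (auto simp: nbhd_def)
  moreover have "card (large_sets {1..0::nat} (m - 1)) \<le> card {{}::nat set}"
    by (intro card_mono) (auto simp: large_sets_def)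
  ultimately show ?case by simp
next
  case (Suc n)
  note up = Suc.prems(1) and sh = Suc.prems(2)
  have ge: "card (large_sets {1..n} (m - 1)) \<le> card (link (Suc n) \<F>)"
    by (rule card_link_ge[OF Suc.IH up sh Suc.prems(4)])
  have "card (large_sets {1..n} (m - 1 - 1)) \<le> card (nbhd (link (Suc n) \<F>))"
    by (intro Suc.IH up_closed_link[OF up sh] shifted_link[OF up sh] ge
        link_nonempty[OF up sh] Suc.prems(3))
  with ge show ?case
    using card_nbhd_ge[OF up sh] by (simp only: card_large_sets_Suc)
qed

text \<open>Equality propagates: link and neighbourhood of the link have extremal size, so induction
  determines the link. Then the part avoiding the last point has extremal size and its neighbourhood
  lies in the link, so induction determines it too.\<close>

lemma shifted_nbhd_unique:
  assumes "up_closed {1..n} \<F>" "shifted n \<F>"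
    and "card \<F> = card (large_sets {1..n} m)"
    and "card (nbhd \<F>) \<le> card (large_sets {1..n} (m - 1))"
  shows "\<F> = large_sets {1..n} m"
  using assms
proof (induction n arbitrary: \<F> m)
  case 0
  \<comment> \<open>Over an empty ground set a family is determined by its size.\<close>
  have eq: "\<G> = (if card \<G> = 0 then {} else {{}})" if "\<G> \<subseteq> {{}}" for \<G> :: "nat set set"
    using subset_singletonD[OF that] by auto
  have "\<F> \<subseteq> {{}}" using 0(1) by (auto simp: up_closed_def)
  moreover have "large_sets {1..0::nat} m \<subseteq> {{}}" by (auto simp: large_sets_def)
  ultimately show ?case
    using eq[of \<F>] eq[of "large_sets {1..0} m"] 0(3) by metis
next
  case (Suc n)
  note up = Suc.prems(1) and sh = Suc.prems(2)
  note fin = finite_parts[OF up sh]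
  let ?L = "link (Suc n) \<F>" and ?V = "avoiding (Suc n) \<F>"
  show ?case
  proof (cases "\<F> = {}")
    case True
    then show ?thesis using Suc.prems(3) finite_large_sets[of "{1..Suc n}" m] by simp
  next
    case False
    have ge: "card (large_sets {1..n} (m - 1)) \<le> card ?L"
      using Suc.prems(3) by (intro card_link_ge[OF shifted_nbhd_ge up sh]) auto
    have "card (large_sets {1..n} (m - 1 - 1)) \<le> card (nbhd ?L)"
      by (intro shifted_nbhd_ge up_closed_link[OF up sh] shifted_link[OF up sh] ge
        link_nonempty[OF up sh] False)
    with ge have eq: "card ?L = card (large_sets {1..n} (m - 1))"
      "card (nbhd ?L) \<le> card (large_sets {1..n} (m - 1 - 1))"
      using card_nbhd_ge[OF up sh] Suc.prems(4) card_large_sets_Suc[of n "m - 1"] by linarith+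
    have L: "?L = large_sets {1..n} (m - 1)"
      by (intro Suc.IH up_closed_link[OF up sh] shifted_link[OF up sh] eq)
    have "card ?V = card (large_sets {1..n} m)"
      using card_avoiding_link[OF fin(1), of "Suc n"] eq(1) Suc.prems(3)
        card_large_sets_Suc[of n m] by linarith
    moreover have "card (nbhd ?V) \<le> card (large_sets {1..n} (m - 1))"
      unfolding eq(1)[symmetric] by (intro card_mono fin nbhd_avoiding_subset_link[OF up sh])
    ultimately have V: "?V = large_sets {1..n} m"
      by (intro Suc.IH up_closed_avoiding[OF up sh] shifted_avoiding[OF up sh])
    show ?thesis
      by (rule avoiding_link_eqI[of "Suc n"])
        (simp_all only: avoiding_large_sets link_large_sets L V)
  qed
qed

section \<open>Shifting\<close>

context
  fixes i j :: 'a
begin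

abbreviation "swap \<equiv> (`) (transpose i j)"

lemma swap_swap [simp]: "swap (swap A) = A"
  by (simp add: image_image)

lemma swap_eq: "i \<in> A \<longleftrightarrow> j \<in> A \<Longrightarrow> swap A = A"
  by (force simp: transpose_def)

lemma swap_eq_insert: "i \<in> A \<Longrightarrow> j \<notin> A \<Longrightarrow> swap A = insert j (A - {i})"
  by (force simp: transpose_def)

lemma mem_swap: "x \<in> swap A \<longleftrightarrow> transpose i j x \<in> A"
  by (metis image_iff transpose_involutory)

lemma swap_Diff: "swap (A - {x}) = swap A - {transpose i j x}"
  by (simp add: image_set_diff)

lemma card_swap: "card (swap A) = card A"
  by (rule card_image) (metis inj_onI transpose_involutory)

lemma swap_subset: "i \<in> U \<Longrightarrow> j \<in> U \<Longrightarrow> A \<subseteq> U \<Longrightarrow> swap A \<subseteq> U"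
  by (auto simp: transpose_def)

text \<open>Compression in membership form: of two sets exchanged by the transposition, the one with
  \<open>j\<close> instead of \<open>i\<close> is kept if either is a member, the other only if both
  are. \<open>shift_eq\<close> is the usual description by moved sets.\<close>

definition shift :: "'a set set \<Rightarrow> 'a set set" where
  "shift \<F> = {A. if j \<in> A \<and> i \<notin> A then A \<in> \<F> \<or> swap A \<in> \<F> else A \<in> \<F> \<and> swap A \<in> \<F>}"

definition movable :: "'a set set \<Rightarrow> 'a set set" where
  "movable \<F> = {A \<in> \<F>. i \<in> A \<and> j \<notin> A \<and> swap A \<notin> \<F>}"

lemma shift_eq: "shift \<F> = (\<F> - movable \<F>) \<union> swap ` movable \<F>"
proof (rule set_eqI)
  fix A
  have im: "A \<in> swap ` movable \<F> \<longleftrightarrow> swap A \<in> movable \<F>"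
  proof
    assume "A \<in> swap ` movable \<F>"
    then obtain B where "A = swap B" "B \<in> movable \<F>" by (rule imageE)
    then show "swap A \<in> movable \<F>" by (simp only: swap_swap)
  next
    assume "swap A \<in> movable \<F>"
    then show "A \<in> swap ` movable \<F>" using swap_swap[of A, symmetric] by (rule rev_image_eqI)
  qed
  show "A \<in> shift \<F> \<longleftrightarrow> A \<in> (\<F> - movable \<F>) \<union> swap ` movable \<F>"
  proof (cases "i \<in> A \<longleftrightarrow> j \<in> A")
    case True
    then show ?thesis
      unfolding Un_iff im by (auto simp: shift_def movable_def swap_eq)
  next
    case False
    then show ?thesis
      unfolding Un_iff im by (auto simp: shift_def movable_def mem_swap)
  qed
qed

text \<open>The additive form avoids subtraction. Constant \<open>g\<close> shows that shifting
  preserves size; the element sum as \<open>g\<close> gives the potential in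
  \<open>ex_shifted\<close>.\<close>

lemma sum_shift:
  fixes g :: "'a set \<Rightarrow> nat"
  assumes "finite \<F>"
  shows "sum g (shift \<F>) + sum g (movable \<F>) = sum g \<F> + (\<Sum>A\<in>movable \<F>. g (swap A))"
proof -
  have fin: "finite (movable \<F>)" and sub: "movable \<F> \<subseteq> \<F>"
    using assms by (auto simp: movable_def)
  have "inj_on swap (movable \<F>)"
    by (rule inj_onI) (metis swap_swap)
  then have "sum g (swap ` movable \<F>) = (\<Sum>A\<in>movable \<F>. g (swap A))"
    by (simp add: sum.reindex)
  moreover have "(\<F> - movable \<F>) \<inter> swap ` movable \<F> = {}"
    by (auto simp: movable_def)
  then have "sum g (shift \<F>) = sum g (\<F> - movable \<F>) + sum g (swap ` movable \<F>)"
    unfolding shift_eq using assms fin by (intro sum.union_disjoint) auto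
  moreover have "sum g \<F> = sum g (\<F> - movable \<F>) + sum g (movable \<F>)"
    by (rule sum.subset_diff[OF sub assms])
  ultimately show ?thesis by simp
qed

lemma card_shift: "finite \<F> \<Longrightarrow> card (shift \<F>) = card \<F>"
  using sum_shift[of \<F> "\<lambda>_. 1"] by simp

text \<open>Keeping the occurring sizes is what carries uniqueness back from the shifted family in
  \<open>nbhd_unique\<close>.\<close>

lemma card_image_subset_shift: "card ` \<F> \<subseteq> card ` shift \<F>"
proof
  fix k assume "k \<in> card ` \<F>"
  then obtain A where A: "A \<in> \<F>" "k = card A" by blast
  show "k \<in> card ` shift \<F>"
  proof (cases "A \<in> movable \<F>")
    case True
    then have "swap A \<in> shift \<F>" by (simp add: shift_eq)
    then show ?thesis using A card_swap[of A] by (metis image_eqI)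
  qed (use A in \<open>auto simp: shift_eq\<close>)
qed

lemma up_closed_shift:
  assumes up: "up_closed U \<F>" and ij: "i \<in> U" "j \<in> U"
  shows "up_closed U (shift \<F>)"
  unfolding up_closed_def
proof (intro conjI ballI allI impI)
  show "shift \<F> \<subseteq> Pow U"
  proof
    fix A assume "A \<in> shift \<F>"
    then have "A \<in> \<F> \<or> swap A \<in> \<F>" by (auto simp: shift_def split: if_splits)
    then show "A \<in> Pow U"
      using up_closed_subset[OF up] swap_subset[OF ij, of "swap A"] by auto
  qed
  fix A B assume A: "A \<in> shift \<F>" and AB: "A \<subseteq> B" "B \<subseteq> U"
  have upA: "A \<in> \<F> \<Longrightarrow> B \<in> \<F>"
    using up_closedD[OF up _ AB] by blast
  have upS: "swap A \<in> \<F> \<Longrightarrow> swap B \<in> \<F>"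
    using up_closedD[OF up _ image_mono[OF AB(1)] swap_subset[OF ij AB(2)]] by blast
  show "B \<in> shift \<F>"
  proof (cases "i \<in> B \<longleftrightarrow> j \<in> B")
    case True
    then show ?thesis
      using A upA upS swap_eq[OF True] by (auto simp: shift_def split: if_splits)
  next
    \<comment> \<open>If \<open>B\<close> contains \<open>i\<close> but not \<open>j\<close>, then
      \<open>j\<close> is not in \<open>A\<close>, so \<open>A\<close> and its swap are both
      members; if \<open>B\<close> contains \<open>j\<close> but not \<open>i\<close>, one of them
      suffices.\<close>
    case False
    then show ?thesis
      using A upA upS AB by (auto simp: shift_def split: if_splits)
  qed
qed

text \<open>Shifting does not enlarge neighbourhoods: deleting \<open>x\<close> from
  \<open>A\<close> corresponds to deleting the transposed point from the swap of
  \<open>A\<close>.\<close>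

lemma nbhd_shift_subset: "nbhd (shift \<F>) \<subseteq> shift (nbhd \<F>)"
proof
  fix C assume "C \<in> nbhd (shift \<F>)"
  then obtain A x where A: "A \<in> shift \<F>" "C = A \<or> C = A - {x}"
    unfolding nbhd_iff by (elim bexE exE)
  have nA: "C \<in> nbhd \<F>" if "A \<in> \<F>"
    using A(2) subsetD[OF subset_nbhd that] Diff_in_nbhd[OF that, of x] by metis
  have nS: "swap C \<in> nbhd \<F>" if "swap A \<in> \<F>"
    using A(2) subsetD[OF subset_nbhd that] Diff_in_nbhd[OF that, of "transpose i j x"]
      swap_Diff[of A x] by metis
  show "C \<in> shift (nbhd \<F>)"
  proof (cases "j \<in> C \<and> i \<notin> C")
    case True
    then show ?thesis
      using A(1) nA nS by (auto simp: shift_def split: if_splits)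
  next
    case C: False
    show ?thesis
    proof (cases "j \<in> A \<and> i \<notin> A")
      case True
      \<comment> \<open>Here the deleted element was \<open>j\<close>, so \<open>C\<close> contains
        neither point and is fixed by the swap.\<close>
      then have "j \<notin> C" "i \<notin> C" using C A(2) by auto
      then have "swap C = C" by (intro swap_eq) simp
      then have "C \<in> nbhd \<F>"
        using A(1) True nA nS by (auto simp: shift_def)
      then show ?thesis using \<open>swap C = C\<close> by (auto simp: shift_def)
    next
      case False
      then have "A \<in> \<F>" "swap A \<in> \<F>" using A(1) by (auto simp: shift_def)
      then show ?thesis using nA nS by (auto simp: shift_def)
    qed
  qed
qed

end

section \<open>Reduction to shifted families\<close>

lemma finite_up_closed: "finite U \<Longrightarrow> up_closed U \<F> \<Longrightarrow> finite \<F>"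
  by (rule finite_subset[of _ "Pow U"]) (auto simp: up_closed_def)

text \<open>Among the up-closed families of the same size that keep all occurring member sizes and
  have no larger neighbourhood, one with maximal total element sum \<open>w\<close> is shifted: any
  effective shift replaces some \<open>i\<close> by a larger \<open>j\<close> and raises
  \<open>w\<close>.\<close>

lemma ex_shifted:
  assumes up: "up_closed {1..n} \<F>"
  obtains \<G> where "up_closed {1..n} \<G>" "shifted n \<G>" "card \<G> = card \<F>"
    "card ` \<F> \<subseteq> card ` \<G>" "card (nbhd \<G>) \<le> card (nbhd \<F>)"
proof -
  define Q where "Q \<G> \<longleftrightarrow> up_closed {1..n} \<G> \<and> card \<G> = card \<F> \<and> card ` \<F> \<subseteq> card ` \<G>
    \<and> card (nbhd \<G>) \<le> card (nbhd \<F>)" for \<G>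
  define w where "w \<G> = (\<Sum>A\<in>\<G>. \<Sum>A)" for \<G> :: "nat set set"
  have "Q \<F>" using up by (simp add: Q_def)
  moreover have "w \<G> \<le> w (Pow {1..n})" if "Q \<G>" for \<G>
    unfolding w_def using that by (intro sum_mono2) (auto simp: Q_def up_closed_def)
  ultimately have "\<exists>\<G>. Q \<G> \<and> (\<forall>\<K>. Q \<K> \<longrightarrow> w \<K> \<le> w \<G>)"
    by (intro ex_has_greatest_nat[of Q \<F> w "Suc (w (Pow {1..n}))"]) (simp_all add: less_Suc_eq_le)
  then obtain \<G> where \<G>: "Q \<G>" and max: "\<And>\<K>. Q \<K> \<Longrightarrow> w \<K> \<le> w \<G>"
    by metis
  have upG: "up_closed {1..n} \<G>" using \<G> by (simp add: Q_def)
  have fin: "finite \<G>" "finite (nbhd \<G>)"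
    using finite_up_closed[OF _ upG] finite_up_closed[OF _ up_closed_nbhd[OF upG]] by simp_all
  have "shifted n \<G>"
    unfolding shifted_def
  proof (intro ballI allI impI, rule ccontr)
    fix A i j assume A: "A \<in> \<G>" and ij: "i \<in> A" "j \<le> n" "i < j" "j \<notin> A"
      and not: "insert j (A - {i}) \<notin> \<G>"
    have U: "i \<in> {1..n}" "j \<in> {1..n}"
      using ij up_closed_subset[OF upG A] by auto
    have "card (nbhd (shift i j \<G>)) \<le> card (shift i j (nbhd \<G>))"
    proof (rule card_mono[OF _ nbhd_shift_subset])
      show "finite (shift i j (nbhd \<G>))"
        by (rule finite_up_closed[OF finite_atLeastAtMost
              up_closed_shift[OF up_closed_nbhd[OF upG] U]])
    qed
    then have "card (nbhd (shift i j \<G>)) \<le> card (nbhd \<G>)"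
      by (simp add: card_shift[OF fin(2)])
    then have "Q (shift i j \<G>)"
      using \<G> up_closed_shift[OF upG U] card_shift[OF fin(1)] card_image_subset_shift[of \<G> i j]
      unfolding Q_def by (metis order_trans)
    then have "w (shift i j \<G>) \<le> w \<G>" by (rule max)
    moreover have "w (shift i j \<G>) + w (movable i j \<G>)
        = w \<G> + (\<Sum>B\<in>movable i j \<G>. \<Sum>(transpose i j ` B))"
      unfolding w_def by (rule sum_shift[OF fin(1)])
    moreover have "w (movable i j \<G>) < (\<Sum>B\<in>movable i j \<G>. \<Sum>(transpose i j ` B))"
      unfolding w_def
    proof (rule sum_strict_mono)
      show "finite (movable i j \<G>)" using fin by (simp add: movable_def)
      show "movable i j \<G> \<noteq> {}"
        using A ij not swap_eq_insert[of i A j] by (auto simp: movable_def)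
      fix B assume "B \<in> movable i j \<G>"
      then have B: "B \<in> \<G>" "i \<in> B" "j \<notin> B" by (auto simp: movable_def)
      then have "finite B" using up_closed_subset[OF upG] by (auto intro: finite_subset)
      then have "\<Sum>B = i + \<Sum>(B - {i})" "\<Sum>(insert j (B - {i})) = j + \<Sum>(B - {i})"
        using B by (auto simp: sum.remove)
      then show "\<Sum>B < \<Sum>(transpose i j ` B)"
        using swap_eq_insert[of i B j] B ij(3) by simp
    qed
    ultimately show False by linarith
  qed
  with \<G> show ?thesis by (intro that[of \<G>]) (simp_all add: Q_def)
qed

lemma nbhd_ge:
  fixes n :: nat
  assumes up: "up_closed {1..n} \<F>" and "\<F> \<noteq> {}"
    and card: "card (large_sets {1..n} m) \<le> card \<F>"
  shows "card (large_sets {1..n} (m - 1)) \<le> card (nbhd \<F>)"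
proof -
  obtain \<G> where \<G>: "up_closed {1..n} \<G>" "shifted n \<G>" "card \<G> = card \<F>"
    "card ` \<F> \<subseteq> card ` \<G>" "card (nbhd \<G>) \<le> card (nbhd \<F>)"
    by (rule ex_shifted[OF up])
  then have "card (large_sets {1..n} (m - 1)) \<le> card (nbhd \<G>)"
    using assms by (intro shifted_nbhd_ge) auto
  then show ?thesis using \<G>(5) by simp
qed

text \<open>The shifted family is extremal, so its members have at least \<open>m\<close> elements.
  Every size occurring in \<open>\<F>\<close> occurs there, which gives an inclusion between
  families of equal size.\<close>

lemma nbhd_unique:
  fixes n :: nat
  assumes up: "up_closed {1..n} \<F>" and card: "card \<F> = card (large_sets {1..n} m)"
    and nbhd: "card (nbhd \<F>) \<le> card (large_sets {1..n} (m - 1))"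
  shows "\<F> = large_sets {1..n} m"
proof -
  obtain \<G> where \<G>: "up_closed {1..n} \<G>" "shifted n \<G>" "card \<G> = card \<F>"
    "card ` \<F> \<subseteq> card ` \<G>" "card (nbhd \<G>) \<le> card (nbhd \<F>)"
    by (rule ex_shifted[OF up])
  then have "\<G> = large_sets {1..n} m"
    using card nbhd by (intro shifted_nbhd_unique) auto
  then have "\<F> \<subseteq> large_sets {1..n} m"
    using \<G>(4) up by (fastforce simp: large_sets_def up_closed_def)
  then show ?thesis
    using card by (intro card_subset_eq finite_large_sets) auto
qed

section \<open>Families without almost-matchings\<close>

lemma almost_matching_antimono:
  assumes sub: "\<And>i. i \<in> {1..s} \<Longrightarrow> A i \<subseteq> B i" and B: "almost_matching n s B"
  shows "almost_matching n s A"
proof -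
  have le: "degree s A x \<le> degree s B x" for x
    unfolding degree_def using sub by (intro card_mono) auto
  have "card {x \<in> {1..n}. degree s A x > 1} \<le> card {x \<in> {1..n}. degree s B x > 1}"
    using le by (intro card_mono) (auto intro: less_le_trans)
  also have "\<dots> \<le> 1" using B by (simp add: almost_matching_def)
  finally show ?thesis
    using B le unfolding almost_matching_def by (meson order_trans)
qed

text \<open>Double counting of incidences: the sets contribute at least \<open>s * m\<close>, while
  the degrees of an almost-matching sum to at most \<open>n + 1\<close>.\<close>

lemma large_sets_no_almost_matching:
  assumes "n + 1 < s * m"
  shows "\<not> contains_almost_matching n s (large_sets {1..n} m)"
proof
  assume "contains_almost_matching n s (large_sets {1..n} m)"
  then obtain A where A: "\<And>i. i \<in> {1..s} \<Longrightarrow> A i \<subseteq> {1..n}" "\<And>i. i \<in> {1..s} \<Longrightarrow> m \<le> card (A i)"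
    and am: "almost_matching n s A"
    unfolding contains_almost_matching_def large_sets_def by blast
  let ?D = "{x \<in> {1..n}. degree s A x > 1}"
  have "s * m = (\<Sum>i\<in>{1..s}. m)" by simp
  also have "\<dots> \<le> (\<Sum>i\<in>{1..s}. card (A i))"
    by (rule sum_mono) (rule A(2))
  also have "\<dots> = (\<Sum>i\<in>{1..s}. card {x \<in> {1..n}. x \<in> A i})"
    using A(1) by (intro sum.cong refl arg_cong[of _ _ card]) blast
  also have "\<dots> = (\<Sum>x\<in>{1..n}. degree s A x)"
    unfolding degree_def by (rule sum_multicount_gen) auto
  also have "\<dots> \<le> (\<Sum>x\<in>{1..n}. 1 + of_bool (x \<in> ?D))"
  proof (rule sum_mono)
    fix x assume "x \<in> {1..n}"
    then have "degree s A x \<le> 2" using am by (simp add: almost_matching_def)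
    then show "degree s A x \<le> 1 + of_bool (x \<in> ?D)"
      using \<open>x \<in> {1..n}\<close> by (cases "degree s A x > 1") auto
  qed
  also have "\<dots> = n + card ?D"
    unfolding sum.distrib by (simp add: of_bool_def sum.If_cases Int_def)
  also have "\<dots> \<le> n + 1" using am by (simp add: almost_matching_def)
  finally show False using assms by simp
qed

text \<open>The new point is 0, which is free in \<open>{1..n}\<close> and extends it to the ground
  set \<open>{..<Suc n}\<close> of \<open>Kleitman\<close>.\<close>

definition add_point :: "nat set set \<Rightarrow> nat set set" where
  "add_point \<F> = \<F> \<union> insert 0 ` nbhd \<F>"

lemma card_add_point:
  assumes "\<F> \<subseteq> Pow {1..n}"
  shows "card (add_point \<F>) = card \<F> + card (nbhd \<F>)"
proof -
  have nb: "nbhd \<F> \<subseteq> Pow {1..n}" by (rule nbhd_subset_Pow[OF assms])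
  have "0 \<notin> A" if "A \<in> nbhd \<F>" for A using subsetD[OF nb that] by auto
  then have "inj_on (insert 0) (nbhd \<F>)"
    by (intro inj_onI) (simp add: insert_ident)
  moreover have "\<F> \<inter> insert 0 ` nbhd \<F> = {}" using assms by auto
  moreover have "finite \<F>" by (rule finite_subset[OF assms]) simp
  moreover have "finite (nbhd \<F>)" by (rule finite_subset[OF nb]) simp
  ultimately show ?thesis
    unfolding add_point_def by (simp add: card_Un_disjoint card_image)
qed

lemma up_closed_add_point:
  assumes up: "up_closed {1..n} \<F>"
  shows "up_closed {..<Suc n} (add_point \<F>)"
proof -
  have U: "{..<Suc n} = insert 0 {1..n}" by auto
  note nb = up_closed_nbhd[OF up]
  show ?thesis
    unfolding up_closed_def
  proof (intro conjI ballI allI impI)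
    show "add_point \<F> \<subseteq> Pow {..<Suc n}"
    proof
      fix A assume "A \<in> add_point \<F>"
      then consider "A \<in> \<F>" | C where "C \<in> nbhd \<F>" "A = insert 0 C"
        by (auto simp: add_point_def)
      then show "A \<in> Pow {..<Suc n}"
        unfolding U using up_closed_subset[OF up] up_closed_subset[OF nb] by cases blast+
    qed
    fix A B assume A: "A \<in> add_point \<F>" and AB: "A \<subseteq> B" "B \<subseteq> {..<Suc n}"
    have sub: "B - {0} \<subseteq> {1..n}" using AB(2) U by auto
    show "B \<in> add_point \<F>"
    proof (cases "0 \<in> B")
      case False
      then have "0 \<notin> A" using AB by blast
      then have "A \<in> \<F>" using A by (auto simp: add_point_def)
      then have "B \<in> \<F>"
        using AB(1) sub False by (simp add: up_closedD[OF up _ AB(1)])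
      then show ?thesis by (simp add: add_point_def)
    next
      case True
      obtain C where C: "C \<in> nbhd \<F>" "C \<subseteq> A" "0 \<notin> C"
      proof (cases "A \<in> \<F>")
        case True
        then show ?thesis
          using subsetD[OF subset_nbhd True] up_closed_subset[OF up True] by (intro that[of A]) auto
      next
        case False
        then obtain C where C: "C \<in> nbhd \<F>" "A = insert 0 C"
          using A by (auto simp: add_point_def)
        then show ?thesis using up_closed_subset[OF nb C(1)] by (intro that[of C]) auto
      qed
      then have "B - {0} \<in> nbhd \<F>"
        using AB(1) sub by (intro up_closedD[OF nb C(1)]) auto
      moreover have "B = insert 0 (B - {0})" using True by auto
      ultimately have "B \<in> insert 0 ` nbhd \<F>" by (rule rev_image_eqI)
      then show ?thesis by (simp add: add_point_def)
    qed
  qed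
qed

text \<open>At most one of the disjoint sets contains 0. Undoing its deletion adds at most one
  point, so replacing all sets by members of \<open>\<F>\<close> creates overlap only at that point,
  with degree at most two.\<close>

lemma add_point_no_matching:
  assumes sub: "\<F> \<subseteq> Pow {1..n}" and no: "\<not> contains_almost_matching n s \<F>"
  shows "\<not> has_matching s (add_point \<F>)"
proof
  assume "has_matching s (add_point \<F>)"
  then obtain A where A: "\<forall>i<s. A i \<in> add_point \<F>"
    and disj: "\<forall>i<s. \<forall>j<s. i \<noteq> j \<longrightarrow> A i \<inter> A j = {}"
    unfolding has_matching_def by (elim exE conjE)
  have "\<exists>B x. B \<in> \<F> \<and> (if 0 \<in> A i then B \<subseteq> insert x (A i) else B = A i)"
    if i: "i < s" for i
  proof (cases "0 \<in> A i")
    case False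
    then show ?thesis using A i by (auto simp: add_point_def)
  next
    case True
    have "A i \<notin> \<F>"
    proof
      assume "A i \<in> \<F>"
      then have "0 \<in> {1..n}" using sub True by blast
      then show False by simp
    qed
    then obtain C where "C \<in> nbhd \<F>" "A i = insert 0 C"
      using A i by (auto simp: add_point_def)
    then show ?thesis using True unfolding nbhd_iff by auto
  qed
  then obtain B x where B: "\<And>i. i < s \<Longrightarrow> B i \<in> \<F>"
    "\<And>i. i < s \<Longrightarrow> if 0 \<in> A i then B i \<subseteq> insert (x i) (A i) else B i = A i"
    by metis
  \<comment> \<open>\<open>r\<close> is the index of the set containing 0, and arbitrary if there is
    none.\<close>
  obtain r where r: "\<And>i. i < s \<Longrightarrow> 0 \<in> A i \<Longrightarrow> i = r"
    using disj by (metis IntI empty_iff)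
  have one: "card {i. i < s \<and> y \<in> A i} \<le> 1" for y
  proof -
    have "i = j" if "i < s" "j < s" "y \<in> A i" "y \<in> A j" for i j
      using disj that by (metis IntI empty_iff)
    then show ?thesis by (auto simp: card_le_Suc0_iff_eq)
  qed
  define D where "D y = {i. i < s \<and> y \<in> B i}" for y
  have D: "D y \<subseteq> {i. i < s \<and> y \<in> A i} \<union> (if y = x r then {r} else {})" for y
  proof
    fix i assume "i \<in> D y"
    then have i: "i < s" "y \<in> B i" by (auto simp: D_def)
    show "i \<in> {i. i < s \<and> y \<in> A i} \<union> (if y = x r then {r} else {})"
      using B(2)[OF i(1)] r[OF i(1)] i by (auto split: if_splits)
  qed
  have D1: "card (D y) \<le> 1" if "y \<noteq> x r" for y
  proof -
    have "card (D y) \<le> card {i. i < s \<and> y \<in> A i}"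
      using D[of y] that by (intro card_mono) auto
    then show ?thesis using one[of y] by simp
  qed
  have D2: "card (D y) \<le> 2" for y
  proof -
    have "card (D y) \<le> card ({i. i < s \<and> y \<in> A i} \<union> {r})"
      using D[of y] by (intro card_mono) (auto split: if_splits)
    also have "\<dots> \<le> card {i. i < s \<and> y \<in> A i} + card {r}" by (rule card_Un_le)
    finally show ?thesis using one[of y] by simp
  qed
  \<comment> \<open>Matchings are indexed by \<open>i < s\<close>, almost-matchings by
    \<open>{1..s}\<close>.\<close>
  define F where "F i = B (i - 1)" for i
  have deg: "degree s F y = card (D y)" for y
  proof -
    have "{i \<in> {1..s}. y \<in> F i} = Suc ` D y"
    proof (intro equalityI subsetI)
      fix i assume "i \<in> {i \<in> {1..s}. y \<in> F i}"
      then have "i - 1 \<in> D y" "i = Suc (i - 1)" by (auto simp: F_def D_def)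
      then show "i \<in> Suc ` D y" by (rule rev_image_eqI)
    qed (auto simp: F_def D_def)
    then show ?thesis by (simp add: degree_def card_image)
  qed
  have "{y \<in> {1..n}. degree s F y > 1} \<subseteq> {x r}"
    using D1 unfolding deg by force
  then have "card {y \<in> {1..n}. degree s F y > 1} \<le> card {x r}"
    by (intro card_mono) auto
  then have "almost_matching n s F"
    using D2 by (simp add: almost_matching_def deg)
  moreover have "\<forall>i\<in>{1..s}. F i \<in> \<F>"
    using B(1) by (auto simp: F_def)
  ultimately show False using no unfolding contains_almost_matching_def by blast
qed

text \<open>\<open>Kleitman\<close> for \<open>add_point \<F>\<close> with \<open>t = s - 1\<close>
  and \<open>k = m - 1\<close>, on \<open>n + 1 = s * m - 1\<close> points.\<close>

lemma card_add_nbhd_le: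
  assumes s: "s \<ge> 2" and m: "m \<ge> 1" and n: "n + 2 = s * m"
    and up: "up_closed {1..n} \<F>" and no: "\<not> contains_almost_matching n s \<F>"
  shows "card \<F> + card (nbhd \<F>) \<le> card (large_sets {1..n} m) + card (large_sets {1..n} (m - 1))"
proof -
  obtain t k where tk: "s = Suc t" "m = Suc k" "t \<ge> 1"
    using s m by (cases s; cases m) auto
  have sub: "\<F> \<subseteq> Pow {1..n}" using up by (simp add: up_closed_def)
  have "Suc n = t * Suc k + k" using n tk by simp
  then have "card (add_point \<F>) \<le> card (large_sets {..<Suc n} (Suc k))"
    using tk(3) up_closed_add_point[OF up] add_point_no_matching[OF sub no, unfolded tk(1)]
    by (rule Kleitman)
  also have "\<dots> = card (large_sets {1..Suc n} (Suc k))"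
    by (simp add: card_large_sets)
  finally show ?thesis
    by (simp only: card_add_point[OF sub] card_large_sets_Suc tk(2))
qed

section \<open>The bound and its equality case\<close>

theorem up_closed_bound:
  assumes s: "s \<ge> 2" and m: "m \<ge> 1" and n: "n + 2 = s * m"
    and up: "up_closed {1..n} \<F>" and no: "\<not> contains_almost_matching n s \<F>"
  shows "card \<F> \<le> card (large_sets {1..n} m)"
    and "card \<F> = card (large_sets {1..n} m) \<Longrightarrow> \<F> = large_sets {1..n} m"
proof -
  note le = card_add_nbhd_le[OF assms]
  show "card \<F> \<le> card (large_sets {1..n} m)"
  proof (rule ccontr)
    \<comment> \<open>A family that is too large also has a neighbourhood of at least extremal size,
      which breaks the joint bound \<open>le\<close>.\<close>
    assume gt: "\<not> ?thesis"
    then have "card (large_sets {1..n} (m - 1)) \<le> card (nbhd \<F>)"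
      by (intro nbhd_ge[OF up]) auto
    with gt le show False by linarith
  qed
  assume eq: "card \<F> = card (large_sets {1..n} m)"
  with le show "\<F> = large_sets {1..n} m"
    by (intro nbhd_unique[OF up]) linarith+
qed

text \<open>Shrinking the sets of an almost-matching only lowers degrees, so one in the up-closure
  yields one in \<open>\<F>\<close>.\<close>

lemma no_almost_matching_up_closure:
  assumes sub: "\<F> \<subseteq> Pow {1..n}" and no: "\<not> contains_almost_matching n s \<F>"
  obtains \<G> where "up_closed {1..n} \<G>" "\<F> \<subseteq> \<G>" "\<not> contains_almost_matching n s \<G>"
proof -
  define \<G> where "\<G> = {B. B \<subseteq> {1..n} \<and> (\<exists>A\<in>\<F>. A \<subseteq> B)}"
  have "up_closed {1..n} \<G>" unfolding up_closed_def \<G>_def by blast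
  moreover have "\<F> \<subseteq> \<G>" using sub by (auto simp: \<G>_def)
  moreover have "\<not> contains_almost_matching n s \<G>"
  proof
    assume "contains_almost_matching n s \<G>"
    then obtain B where B: "\<forall>i\<in>{1..s}. B i \<in> \<G>" "almost_matching n s B"
      unfolding contains_almost_matching_def by blast
    then have "\<forall>i\<in>{1..s}. \<exists>A\<in>\<F>. A \<subseteq> B i" by (auto simp: \<G>_def)
    then obtain A where A: "\<forall>i\<in>{1..s}. A i \<in> \<F> \<and> A i \<subseteq> B i" by metis
    then have "almost_matching n s A"
      using almost_matching_antimono[OF _ B(2)] by blast
    with A no show False unfolding contains_almost_matching_def by blast
  qed
  ultimately show ?thesis by (rule that)
qed

theorem theorem7:
  fixes s m n :: nat
  assumes "s \<ge> 2" and "m \<ge> 1" and "n = s * m - 2"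
  shows "a n s = (\<Sum>t = m..n. n choose t) \<and>
    (\<forall>\<F>. \<F> \<subseteq> Pow {1..n} \<longrightarrow> \<not> contains_almost_matching n s \<F> \<longrightarrow>
       card \<F> = a n s \<longrightarrow> \<F> = {F. F \<subseteq> {1..n} \<and> card F \<ge> m})"
proof -
  let ?L = "large_sets {1..n} m"
  \<comment> \<open>This shows that the subtraction in \<open>n = s * m - 2\<close> is not
    truncated.\<close>
  have "2 * 1 \<le> s * m" using assms by (intro mult_le_mono) auto
  then have n: "n + 2 = s * m" using assms by simp
  note bound = up_closed_bound[OF assms(1,2) n]
  have le: "card \<F> \<le> card ?L" and uniq: "card \<F> = card ?L \<Longrightarrow> \<F> = ?L"
    if \<F>: "\<F> \<subseteq> Pow {1..n}" "\<not> contains_almost_matching n s \<F>" for \<F>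
  proof -
    obtain \<G> where \<G>: "up_closed {1..n} \<G>" "\<F> \<subseteq> \<G>" "\<not> contains_almost_matching n s \<G>"
      by (rule no_almost_matching_up_closure[OF \<F>])
    have fin: "finite \<G>" by (rule finite_up_closed[OF _ \<G>(1)]) simp
    then have mono: "card \<F> \<le> card \<G>" using \<G>(2) by (rule card_mono)
    with bound(1)[OF \<G>(1,3)] show "card \<F> \<le> card ?L" by simp
    \<comment> \<open>An extremal \<open>\<F>\<close> makes the up-closed family \<open>\<G>\<close>
      above it extremal, so \<open>\<G>\<close> is \<open>?L\<close>, and equal size gives
      \<open>\<F> = \<G>\<close>.\<close>
    assume eq: "card \<F> = card ?L"
    with mono bound(1)[OF \<G>(1,3)] have "card \<G> = card ?L" by simp
    with bound(2)[OF \<G>(1,3)] eq card_subset_eq[OF fin \<G>(2)] show "\<F> = ?L" by simp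
  qed
  have "a n s = card ?L"
    unfolding a_def
  proof (rule Max_eqI)
    show "finite {card \<F> |\<F>. \<F> \<subseteq> Pow {1..n} \<and> \<not> contains_almost_matching n s \<F>}"
      by (rule finite_subset[of _ "card ` Pow (Pow {1..n})"]) auto
    show "card ?L \<in> {card \<F> |\<F>. \<F> \<subseteq> Pow {1..n} \<and> \<not> contains_almost_matching n s \<F>}"
      using large_sets_no_almost_matching[of n s m] n by (auto simp: large_sets_def)
  qed (use le in auto)
  moreover have "card ?L = (\<Sum>t = m..n. n choose t)"
    using card_large_sets[of "{1..n}" m] by simp
  moreover have "?L = {F. F \<subseteq> {1..n} \<and> card F \<ge> m}"
    by (simp add: large_sets_def)
  ultimately show ?thesis
    using uniq by metis
qed

end
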